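(* Let $\delta\in[0,0.5]$. There is no randomized mechanism $f$ for the line, augmented with full predictions $\hat{\mathbf{x}}$ (containing a predicted location for each agent), that is truthful in expectation, $(1+\delta)$-consistent, and $\beta$-robust for some $\beta<2-\delta$.
   Context: Facility location on the line. There are $n$ agents with location profile $\mathbf{x}=\langle x_1,\dots,x_n\rangle\in\mathbb{R}^n$; $d(a,b)=|a-b|$. A full prediction is a vector $\hat{\mathbf{x}}=\langle \hat x_1,\dots,\hat x_n\rangle\in\mathbb{R}^n$; it is accurate for $\mathbf{x}$ if $\hat{\mathbf{x}}=\mathbf{x}$. A (randomized) mechanism $f$ assigns to every number of agents $n$, every profile $\mathbf{x}\in\mathbb{R}^n$ and every prediction $\hat{\mathbf{x}}\in\mathbb{R}^n$ a random facility location $f(\mathbf{x},\hat{\mathbf{x}})$, i.e. a Borel probability distribution on $\mathbb{R}$. Standing assumptions on mechanisms: unanimous (if all $x_i$ equal a common point $p$, then the facility is at $p$); anonymous (for a fixed prediction, the outcome distribution is unchanged when the reported locations are permuted among the agents); scale-independent (multiplying all reported and all predicted locations by the same $\lambda>0$ multiplies the random facility location by $\lambda$). Truthful in expectation: for every prediction $\hat{\mathbf{x}}$, every $\mathbf{x}$, every agent $i$ and every $x_i'\in\mathbb{R}$, $\mathbb{E}[d(x_i,f(\mathbf{x},\hat{\mathbf{x}}))]\le \mathbb{E}[d(x_i,f((\mathbf{x}_{-i},x_i'),\hat{\mathbf{x}}))]$, where $(\mathbf{x}_{-i},x_i')$ is $\mathbf{x}$ with $x_i$ replaced by $x_i'$.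 Egalitarian social cost: $C(f(\mathbf{x},\hat{\mathbf{x}}),\mathbf{x})=\mathbb{E}[\max_i d(x_i,f(\mathbf{x},\hat{\mathbf{x}}))]$. The optimal location $o(\mathbf{x})$ minimizes $\max_i d(x_i,y)$ over $y\in\mathbb{R}$, with optimal cost $C(o(\mathbf{x}),\mathbf{x})$. The mechanism is $\alpha$-consistent if $C(f(\mathbf{x},\hat{\mathbf{x}}),\mathbf{x})\le\alpha\, C(o(\mathbf{x}),\mathbf{x})$ for all $\mathbf{x}$ and all $\hat{\mathbf{x}}$ accurate for $\mathbf{x}$; it is $\beta$-robust if $C(f(\mathbf{x},\hat{\mathbf{x}}),\mathbf{x})\le\beta\, C(o(\mathbf{x}),\mathbf{x})$ for all $\mathbf{x}$ and all $\hat{\mathbf{x}}$. *)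

theory Defs
  imports "HOL-Probability.Probability"
begin

text \<open>
  A profile of n agents is a list of n reals, and so is a prediction for it.  A mechanism is
  evaluated on a nonempty profile and a prediction of the same length; its values on all other
  pairs of lists are unconstrained.
\<close>

type_synonym mechanism = "real list \<Rightarrow> real list \<Rightarrow> real measure"

definition instance_lists :: "real list \<Rightarrow> real list \<Rightarrow> bool" where
  "instance_lists xs xh \<longleftrightarrow> xs \<noteq> [] \<and> length xh = length xs"

definition randomized_mechanism :: "mechanism \<Rightarrow> bool" where
  "randomized_mechanism f \<longleftrightarrow>
     (\<forall>xs xh. instance_lists xs xh \<longrightarrow> prob_space (f xs xh) \<and> sets (f xs xh) = sets borel)"

definition unanimous :: "mechanism \<Rightarrow> bool" where
  "unanimous f \<longleftrightarrow>
     (\<forall>xs xh p. instance_lists xs xh \<and> (\<forall>i<length xs. xs ! i = p) \<longrightarrow> f xs xh = return borel p)"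

definition anonymous :: "mechanism \<Rightarrow> bool" where
  "anonymous f \<longleftrightarrow>
     (\<forall>xs xh \<pi>. instance_lists xs xh \<and> \<pi> permutes {..<length xs} \<longrightarrow>
        f (permute_list \<pi> xs) xh = f xs xh)"

definition scale_independent :: "mechanism \<Rightarrow> bool" where
  "scale_independent f \<longleftrightarrow>
     (\<forall>xs xh (c::real). instance_lists xs xh \<and> 0 < c \<longrightarrow>
        f (map (\<lambda>x. c * x) xs) (map (\<lambda>x. c * x) xh) = distr (f xs xh) borel (\<lambda>y. c * y))"

text \<open>
  Expectations of distances and costs are nonnegative Lebesgue integrals, so that a distribution
  without a finite first moment has cost infinity.
\<close>

definition expected_dist :: "real \<Rightarrow> real measure \<Rightarrow> ennreal" where
  "expected_dist x M = (\<integral>\<^sup>+ y. ennreal (dist x y) \<partial>M)"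

definition truthful_in_expectation :: "mechanism \<Rightarrow> bool" where
  "truthful_in_expectation f \<longleftrightarrow>
     (\<forall>xs xh i x'. instance_lists xs xh \<and> i < length xs \<longrightarrow>
        expected_dist (xs ! i) (f xs xh) \<le> expected_dist (xs ! i) (f (xs[i := x']) xh))"

definition max_dist :: "real list \<Rightarrow> real \<Rightarrow> real" where
  "max_dist xs y = Max ((\<lambda>x. dist x y) ` set xs)"

definition egalitarian_cost :: "real measure \<Rightarrow> real list \<Rightarrow> ennreal" where
  "egalitarian_cost M xs = (\<integral>\<^sup>+ y. ennreal (max_dist xs y) \<partial>M)"

definition optimal_location :: "real list \<Rightarrow> real" where
  "optimal_location xs = (ARG_MIN (max_dist xs) y. True)"

text \<open>
  The bounds are compared in the extended reals, because \<^const>\<open>ennreal\<close> would truncate a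
  negative approximation factor to 0.
\<close>

definition consistent :: "real \<Rightarrow> mechanism \<Rightarrow> bool" where
  "consistent \<alpha> f \<longleftrightarrow>
     (\<forall>xs xh. instance_lists xs xh \<and> xh = xs \<longrightarrow>
        enn2ereal (egalitarian_cost (f xs xh) xs) \<le> ereal (\<alpha> * max_dist xs (optimal_location xs)))"

definition robust :: "real \<Rightarrow> mechanism \<Rightarrow> bool" where
  "robust \<beta> f \<longleftrightarrow>
     (\<forall>xs xh. instance_lists xs xh \<longrightarrow>
        enn2ereal (egalitarian_cost (f xs xh) xs) \<le> ereal (\<beta> * max_dist xs (optimal_location xs)))"

end

theory Submission
  imports Defs
begin

text \<open>
  Fix the prediction \<open>\<langle>0, 2\<rangle>\<close> and write \<open>A\<close>, \<open>B\<close>, \<open>C\<close> for the outcomes on the profiles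
  \<open>\<langle>0, 2\<rangle>\<close>, \<open>\<langle>0, 1\<rangle>\<close>, \<open>\<langle>-1, 1\<rangle>\<close>.  The cost of two agents at distance \<open>2r\<close> is \<open>r\<close> plus the expected
  distance of the facility to their midpoint.  Hence consistency on \<open>\<langle>0, 2\<rangle>\<close> bounds the expected
  distance of \<open>A\<close> to 1 by \<open>\<delta>\<close>, and robustness on \<open>\<langle>-1, 1\<rangle>\<close> bounds that of \<open>C\<close> to 0 by \<open>\<beta> - 1\<close>.
  On \<open>\<langle>0, 1\<rangle>\<close> the right agent can produce \<open>A\<close> and the left agent can produce \<open>C\<close>, so \<open>B\<close> has
  expected distance at most \<open>\<delta>\<close> to 1 and at most \<open>\<beta> - 1\<close> to 0.  These two distances sum to at
  least 1, so \<open>\<beta> \<ge> 2 - \<delta>\<close>.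
\<close>

text \<open>The endpoint farther from \<open>y\<close> is the one across the midpoint, so the path
  to it passes through \<open>m\<close>.\<close>

lemma max_dist_pair:
  assumes "0 \<le> r"
  shows "max_dist [m - r, m + r] y = r + dist m y"
  using assms by (auto simp: max_dist_def dist_real_def max_def)

lemma max_dist_optimal_location_pair:
  assumes "0 \<le> r"
  shows "max_dist [m - r, m + r] (optimal_location [m - r, m + r]) = r"
  unfolding optimal_location_def
  by (subst arg_min_equality[where k = m]) (simp_all add: max_dist_pair assms)

lemma egalitarian_cost_pair:
  assumes "prob_space M" and "sets M = sets borel" and "0 \<le> r"
  shows "egalitarian_cost M [m - r, m + r] = ennreal r + expected_dist m M"
proof -
  interpret prob_space M by fact
  note assms(2)[measurable_cong]
  show ?thesis
    by (simp add: egalitarian_cost_def expected_dist_def max_dist_pair assms(3) ennreal_plus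
        nn_integral_add emeasure_space_1)
qed

lemma expected_dist_le_of_cost_pair:
  assumes "prob_space M" and "sets M = sets borel" and "0 \<le> r"
    and cost: "enn2ereal (egalitarian_cost M [m - r, m + r])
      \<le> ereal (c * max_dist [m - r, m + r] (optimal_location [m - r, m + r]))"
  shows "enn2ereal (expected_dist m M) \<le> ereal ((c - 1) * r)"
proof -
  have "ereal r + enn2ereal (expected_dist m M) \<le> ereal (c * r)"
    using cost assms(1-3)
    by (simp add: egalitarian_cost_pair max_dist_optimal_location_pair plus_ennreal.rep_eq
        enn2ereal_ennreal)
  \<comment> \<open>Cancelling \<open>r\<close> is legitimate because the finite right-hand side
    rules out an infinite expected distance.\<close>
  then show ?thesis
    by (cases "enn2ereal (expected_dist m M)") (auto simp: algebra_simps)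
qed

text \<open>Integrate the triangle inequality through \<open>y\<close> against a measure of total
  mass 1.\<close>

lemma dist_le_expected_dist_add:
  assumes "prob_space M" and "sets M = sets borel"
  shows "ennreal (dist a b) \<le> expected_dist a M + expected_dist b M"
proof -
  interpret prob_space M by fact
  note assms(2)[measurable_cong]
  have "ennreal (dist a b) = (\<integral>\<^sup>+ y. ennreal (dist a b) \<partial>M)"
    by (simp add: emeasure_space_1)
  also have "\<dots> \<le> (\<integral>\<^sup>+ y. ennreal (dist a y) + ennreal (dist b y) \<partial>M)"
    by (intro nn_integral_mono) (simp flip: ennreal_plus add: dist_triangle2 ennreal_leI)
  also have "\<dots> = expected_dist a M + expected_dist b M"
    unfolding expected_dist_def by (rule nn_integral_add) measurable
  finally show ?thesis .
qed

theorem theorem1: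
  fixes \<delta> :: real
  assumes "0 \<le> \<delta>" and "\<delta> \<le> 1 / 2"
  shows "\<not> (\<exists>(f :: mechanism) (\<beta> :: real).
           randomized_mechanism f \<and> unanimous f \<and> anonymous f \<and> scale_independent f \<and>
           truthful_in_expectation f \<and> consistent (1 + \<delta>) f \<and> robust \<beta> f \<and> \<beta> < 2 - \<delta>)"
proof clarify
  fix f :: mechanism and \<beta> :: real
  assume mech: "randomized_mechanism f" and truth: "truthful_in_expectation f"
    and cons: "consistent (1 + \<delta>) f" and rob: "robust \<beta> f" and less: "\<beta> < 2 - \<delta>"
  define A where "A = f [0, 2] [0, 2]"
  define B where "B = f [0, 1] [0, 2]"
  define C where "C = f [-1, 1] [0, 2]"
  have inst: "instance_lists [a, b] [0, 2]" for a b
    by (simp add: instance_lists_def)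
  have prob: "prob_space (f [a, b] [0, 2])" "sets (f [a, b] [0, 2]) = sets borel" for a b
    using mech inst by (auto simp: randomized_mechanism_def)
  have A: "enn2ereal (expected_dist 1 A) \<le> ereal \<delta>"
    using expected_dist_le_of_cost_pair[of A 1 1 "1 + \<delta>"] cons[unfolded consistent_def] inst
    by (simp add: A_def prob)
  have C: "enn2ereal (expected_dist 0 C) \<le> ereal (\<beta> - 1)"
    using expected_dist_le_of_cost_pair[of C 1 0 \<beta>] rob[unfolded robust_def] inst
    by (simp add: C_def prob)
  have BA: "expected_dist 1 B \<le> expected_dist 1 A"
    using truth[unfolded truthful_in_expectation_def, rule_format, of "[0, 1]" "[0, 2]" 1 2] inst
    by (simp add: A_def B_def)
  have BC: "expected_dist 0 B \<le> expected_dist 0 C"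
    using truth[unfolded truthful_in_expectation_def, rule_format, of "[0, 1]" "[0, 2]" 0 "-1"] inst
    by (simp add: B_def C_def)
  have "1 \<le> expected_dist 0 B + expected_dist 1 B"
    using dist_le_expected_dist_add[of B 0 1] by (simp add: B_def prob)
  also have "\<dots> \<le> expected_dist 0 C + expected_dist 1 A"
    by (intro add_mono BA BC)
  \<comment> \<open>The chain passes to \<open>ereal\<close> because the sign of
    \<open>\<beta> - 1\<close> is not known here.\<close>
  finally have "1 \<le> enn2ereal (expected_dist 0 C) + enn2ereal (expected_dist 1 A)"
    by (simp add: less_eq_ennreal.rep_eq one_ennreal.rep_eq plus_ennreal.rep_eq)
  also have "\<dots> \<le> ereal (\<beta> - 1) + ereal \<delta>"
    by (intro add_mono A C)
  finally show False
    using less by (simp add: one_ereal_def)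
qed

end
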